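(* Let $h=(h(n))_{n\ge 1}$ be a sequence of positive real numbers with $h(1)=1$, and let $n\ge 2$. Then the polynomial $P_n^h(z)$ has a unique zero of maximal modulus among its complex zeros. This zero is real, negative, and simple.
   Context: For a sequence $h=(h(n))_{n\ge1}$ of positive real numbers with $h(1)=1$, the generalized D'Arcais polynomials $P_n^h(z)$ are defined recursively by $P_0^h(z)=1$ and, for $n\ge 1$, \[ P_n^h(z)=\frac{z}{h(n)}\sum_{k=1}^n \sigma(k)\,P_{n-k}^h(z), \] where $\sigma(k)=\sum_{d\mid k} d$ is the sum of the positive divisors of $k$. "Unique zero of maximal modulus" means that there is a zero $\alpha$ such that every zero $\beta\ne\alpha$ satisfies $|\beta|<|\alpha|$; "simple" means multiplicity one. *)

theory Defs
  imports Complex_Main "HOL-Computational_Algebra.Polynomial"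
begin

definition divisor_sum :: "nat \<Rightarrow> nat" where
  "divisor_sum k = (\<Sum>d | d dvd k. d)"

text \<open>The sequence \<open>h\<close> is indexed from 1; the value \<open>h 0\<close> is never used.
  The factor \<open>[:0, 1 / h n:]\<close> is the polynomial \<open>z / h(n)\<close>.\<close>

function darcais :: "(nat \<Rightarrow> real) \<Rightarrow> nat \<Rightarrow> real poly" where
  "darcais h 0 = 1"
| "n \<ge> 1 \<Longrightarrow> darcais h n =
     [:0, 1 / h n:] * (\<Sum>k=1..n. smult (real (divisor_sum k)) (darcais h (n - k)))"
  by (auto, metis One_nat_def Suc_leI gr0I)
termination
  by (relation "measure snd") auto

definition darcais_complex :: "(nat \<Rightarrow> real) \<Rightarrow> nat \<Rightarrow> complex poly" where
  "darcais_complex h n = map_poly complex_of_real (darcais h n)"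

definition unique_zero_of_maximal_modulus :: "complex poly \<Rightarrow> complex \<Rightarrow> bool" where
  "unique_zero_of_maximal_modulus p \<alpha> \<longleftrightarrow>
     poly p \<alpha> = 0 \<and> (\<forall>\<beta>. poly p \<beta> = 0 \<and> \<beta> \<noteq> \<alpha> \<longrightarrow> norm \<beta> < norm \<alpha>)"

end

theory Submission
  imports Defs "HOL-Computational_Algebra.Formal_Power_Series"
begin

text \<open>
  Let \<open>R\<^sub>m(x) = (-1)^m P\<^sub>m(-x)\<close>. The reciprocal \<open>D\<close> of the series
  \<open>\<Sum>\<^sub>k (-1)^k \<sigma>(k+1) q^k\<close> turns the recursion into
  \<open>x R\<^sub>m = \<Sum>\<^sub>i\<^sub>\<le>\<^sub>m D\<^sub>m\<^sub>-\<^sub>i h(i+1) R\<^sub>i\<^sub>+\<^sub>1\<close>, and all coefficients of \<open>D\<close>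
  are positive. So the nonzero roots of \<open>R\<^sub>n\<close> are eigenvalues of a Hessenberg matrix with
  positive entries on and below the superdiagonal, and the assertion is of Perron-Frobenius type.
  The eigenvector for a root \<open>z\<close> is \<open>(R\<^sub>1(z), \<dots>, R\<^sub>n\<^sub>-\<^sub>1(z))\<close>; it is positive at the largest
  real root, and comparing with it bounds the other roots and excludes multiplicity.
\<close>

section \<open>Polynomials with a positive Hessenberg recurrence\<close>

abbreviation cpoly :: "real poly \<Rightarrow> complex poly" where
  "cpoly \<equiv> map_poly complex_of_real"

lemma cpoly_add: "cpoly (p + q) = cpoly p + cpoly q"
  by (simp add: poly_eq_iff coeff_map_poly)

lemma cpoly_smult: "cpoly (smult a p) = smult (of_real a) (cpoly p)"
  by (simp add: poly_eq_iff coeff_map_poly)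

lemma cpoly_sum: "cpoly (\<Sum>i\<in>I. f i) = (\<Sum>i\<in>I. cpoly (f i))"
  by (induction I rule: infinite_finite_induct) (simp_all add: cpoly_add)

lemma pderiv_sum: "pderiv (\<Sum>i\<in>I. f i) = (\<Sum>i\<in>I. pderiv (f i))"
  by (induction I rule: infinite_finite_induct) (simp_all add: pderiv_add)

lemma poly_cpoly_of_real: "poly (cpoly p) (of_real x) = of_real (poly p x)"
  by (induction p) (simp_all add: map_poly_pCons)

lemma poly_cpoly_reflect:
  "poly (cpoly (pcompose p [:0, -1:])) z = poly (cpoly p) (- z)"
proof (induction p)
  case (pCons a p)
  have "pcompose (pCons a p) [:0, -1:] = pCons a (smult (-1) (pcompose p [:0, -1:]))"
    by (simp add: pcompose_pCons)
  then have "cpoly (pcompose (pCons a p) [:0, -1:])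
      = pCons (of_real a) (smult (-1) (cpoly (pcompose p [:0, -1:])))"
    by (simp only: map_poly_pCons cpoly_smult of_real_0 of_real_minus of_real_1)
  then show ?case
    using pCons by (simp add: map_poly_pCons cpoly_smult)
qed simp

text \<open>The disc touches the circle of radius \<open>r\<close> only at \<open>r\<close>: for
  \<open>norm z = r\<close>, expanding the squared norms gives
  \<open>a * r \<le> a * Re z\<close>.\<close>

lemma norm_less_of_internally_tangent_disc:
  fixes z :: complex
  assumes "0 < a" and disc: "norm (z - of_real a) \<le> r - a" and "z \<noteq> of_real r"
  shows "norm z < r"
proof -
  have le: "norm z \<le> r"
    using norm_triangle_ineq[of "z - of_real a" "of_real a"] assms by simp
  have "norm z \<noteq> r"
  proof
    assume eq: "norm z = r"
    have "(norm (z - of_real a))\<^sup>2 \<le> (r - a)\<^sup>2"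
      using disc by (simp add: power_mono)
    then have "(Re z - a)\<^sup>2 + (Im z)\<^sup>2 \<le> (r - a)\<^sup>2"
      by (simp add: cmod_power2)
    moreover have sq: "(Re z)\<^sup>2 + (Im z)\<^sup>2 = r\<^sup>2"
      using eq cmod_power2[of z] by simp
    ultimately have "a * r \<le> a * Re z"
      by (simp add: power2_eq_square algebra_simps)
    then have "Re z = r"
      using \<open>0 < a\<close> complex_Re_le_cmod[of z] eq by simp
    then have "z = of_real r"
      using sq by (simp add: complex_eq_iff)
    then show False using assms by simp
  qed
  with le show ?thesis by simp
qed

text \<open>\<open>U m\<close> plays the role of \<open>R\<^sub>m\<^sub>+\<^sub>1\<close>. At a root
  of \<open>U n\<close> the last term of row \<open>n - 1\<close> vanishes, so the values of
  \<open>U 0\<close>, ..., \<open>U (n - 1)\<close> satisfy the eigenvector equation of the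
  truncated matrix.\<close>

locale hessenberg_polys =
  fixes U :: "nat \<Rightarrow> real poly" and a :: "nat \<Rightarrow> nat \<Rightarrow> real" and c :: real
  assumes U_0: "U 0 = [:0, c:]"
    and c_pos: "c > 0"
    and a_pos: "i \<le> Suc m \<Longrightarrow> a m i > 0"
    and rec: "pCons 0 (U m) = (\<Sum>i\<le>Suc m. smult (a m i) (U i))"
begin

lemma rec_poly: "x * poly (U m) x = (\<Sum>i\<le>Suc m. a m i * poly (U i) x)"
proof -
  have "poly (pCons 0 (U m)) x = (\<Sum>i\<le>Suc m. a m i * poly (U i) x)"
    unfolding rec by (simp add: poly_sum)
  then show ?thesis by simp
qed

lemma rec_cpoly:
  "z * poly (cpoly (U m)) z = (\<Sum>i\<le>Suc m. of_real (a m i) * poly (cpoly (U i)) z)"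
proof -
  have "poly (cpoly (pCons 0 (U m))) z
      = (\<Sum>i\<le>Suc m. of_real (a m i) * poly (cpoly (U i)) z)"
    unfolding rec by (simp add: cpoly_sum cpoly_add cpoly_smult poly_sum)
  then show ?thesis by (simp add: map_poly_pCons)
qed

lemma rec_pderiv:
  "poly (U m) x + x * poly (pderiv (U m)) x = (\<Sum>i\<le>Suc m. a m i * poly (pderiv (U i)) x)"
proof -
  have "poly (pderiv (pCons 0 (U m))) x = (\<Sum>i\<le>Suc m. a m i * poly (pderiv (U i)) x)"
    unfolding rec by (simp add: pderiv_add pderiv_sum pderiv_smult poly_sum)
  then show ?thesis by (simp add: pderiv_pCons)
qed

lemma degree_U: "degree (U m) \<le> Suc m \<and> coeff (U m) (Suc m) > 0"
proof (induction m rule: less_induct)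
  case (less m)
  show ?case
  proof (cases m)
    case 0
    then show ?thesis using c_pos by (simp add: U_0)
  next
    case (Suc k)
    let ?V = "\<Sum>i\<le>k. smult (a k i) (U i)"
    have eq: "smult (a k (Suc k)) (U (Suc k)) = pCons 0 (U k) - ?V"
      using rec[of k] by simp
    have V: "degree ?V \<le> Suc k"
    proof (rule degree_sum_le)
      fix i assume "i \<in> {..k}"
      then show "degree (smult (a k i) (U i)) \<le> Suc k"
        using less[of i] Suc degree_smult_le[of "a k i" "U i"] by fastforce
    qed simp
    have U: "degree (U k) \<le> Suc k" "coeff (U k) (Suc k) > 0"
      using less[of k] Suc by auto
    have "degree (pCons 0 (U k)) \<le> Suc (Suc k)"
      using U(1) degree_pCons_le[of 0 "U k"] by linarith
    then have "degree (smult (a k (Suc k)) (U (Suc k))) \<le> Suc (Suc k)"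
      unfolding eq using V by (intro degree_diff_le) auto
    moreover have "coeff (smult (a k (Suc k)) (U (Suc k))) (Suc (Suc k)) > 0"
      unfolding eq using V U(2) coeff_eq_0[of ?V "Suc (Suc k)"] by simp
    ultimately show ?thesis
      using a_pos[of "Suc k" k] Suc by (simp add: zero_less_mult_iff)
  qed
qed

lemma eventually_positive: "\<exists>b. \<forall>x\<ge>b. poly (U m) x > 0"
proof -
  have "degree (U m) = Suc m"
    using degree_U[of m] le_degree[of "U m" "Suc m"] by force
  then have "lead_coeff (U m) > 0"
    using degree_U[of m] by simp
  then show ?thesis
    using poly_pinfty_gt_lc[of "U m"] by (meson less_le_trans)
qed

text \<open>At the largest root of \<open>U n\<close> the recurrence makes \<open>U (n + 1)\<close> negative, so the largest
  roots increase with \<open>n\<close>.\<close>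

lemma largest_root:
  assumes "n \<ge> 1"
  shows "\<exists>r>0. poly (U n) r = 0 \<and> (\<forall>i<n. poly (U i) r > 0) \<and>
    (\<forall>x>r. \<forall>i\<le>n. poly (U i) x > 0)"
  using assms
proof (induction n rule: nat_induct_at_least)
  case base
  have eq: "a 0 1 * poly (U 1) x = (x - a 0 0) * poly (U 0) x" for x
    using rec_poly[of x 0] by (simp add: algebra_simps)
  have a: "a 0 0 > 0" "a 0 1 > 0" using a_pos[of _ 0] by auto
  have U0: "poly (U 0) x > 0" if "x > 0" for x
    using that c_pos by (simp add: U_0)
  have "poly (U 1) (a 0 0) = 0"
    using eq[of "a 0 0"] a by simp
  moreover have "poly (U 1) x > 0" if "x > a 0 0" for x
  proof -
    have "a 0 1 * poly (U 1) x > 0"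
      unfolding eq using that a U0[of x] by simp
    then show ?thesis using a by (simp add: zero_less_mult_iff)
  qed
  moreover have "poly (U i) x > 0" if "x > a 0 0" "i \<le> 1" for x i
    using that calculation(2)[of x] U0[of x] a by (cases i) auto
  ultimately show ?case
    using U0 a by (intro exI[of _ "a 0 0"]) auto
next
  case (Suc n)
  then obtain r where r: "r > 0" "poly (U n) r = 0" "\<And>i. i < n \<Longrightarrow> poly (U i) r > 0"
    "\<And>x i. x > r \<Longrightarrow> i \<le> n \<Longrightarrow> poly (U i) x > 0"
    by blast
  have "(\<Sum>i\<le>Suc n. a n i * poly (U i) r) = 0"
    using rec_poly[of r n] r(2) by simp
  moreover have "(\<Sum>i\<le>n. a n i * poly (U i) r) > 0"
  proof (rule sum_pos2[of _ 0])
    show "0 < a n 0 * poly (U 0) r" using a_pos[of 0 n] r(3)[of 0] Suc by simp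
    show "0 \<le> a n i * poly (U i) r" if "i \<in> {..n}" for i
      using a_pos[of i n] r(2) r(3)[of i] that by (cases "i = n") auto
  qed auto
  ultimately have "a n (Suc n) * poly (U (Suc n)) r < 0"
    by simp
  then have neg: "poly (U (Suc n)) r < 0"
    using a_pos[of "Suc n" n] by (simp add: mult_less_0_iff)
  obtain b0 where b0: "\<And>x. x \<ge> b0 \<Longrightarrow> poly (U (Suc n)) x > 0"
    using eventually_positive by blast
  define b where "b = max b0 (r + 1)"
  have b: "\<And>x. x \<ge> b \<Longrightarrow> poly (U (Suc n)) x > 0" "b > r"
    using b0 unfolding b_def by auto
  define Z where "Z = {x. poly (U (Suc n)) x = 0} \<inter> {r<..}"
  have "U (Suc n) \<noteq> 0" using neg by auto
  then have fin: "finite Z"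
    unfolding Z_def using poly_roots_finite by blast
  have ne: "Z \<noteq> {}"
    using poly_IVT_pos[OF b(2) neg] b(1)[of b] unfolding Z_def by auto
  define s where "s = Max Z"
  have s: "s > r" "poly (U (Suc n)) s = 0"
    using Max_in[OF fin ne] unfolding s_def Z_def by auto
  have max: "poly (U (Suc n)) x \<noteq> 0" if "x > s" for x
    using Max_ge[OF fin, of x] that s(1) unfolding s_def Z_def by force
  have pos: "poly (U (Suc n)) x > 0" if "x > s" for x
  proof (rule ccontr)
    assume "\<not> poly (U (Suc n)) x > 0"
    then have neg': "poly (U (Suc n)) x < 0" using max[OF that] by simp
    define y where "y = max b (x + 1)"
    have "poly (U (Suc n)) y > 0" "x < y"
      using b(1)[of y] unfolding y_def by auto
    then obtain t where "t > x" "poly (U (Suc n)) t = 0"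
      using poly_IVT_pos[of x y] neg' by blast
    then show False using max[of t] that by simp
  qed
  \<comment> \<open>Since \<open>s > r\<close>, the induction hypothesis to the right of
    \<open>r\<close> gives positivity of \<open>U 0\<close>, ..., \<open>U n\<close> both at
    \<open>s\<close> and beyond it.\<close>
  show ?case
  proof (intro exI[of _ s] conjI allI impI)
    show "poly (U i) x > 0" if "x > s" "i \<le> Suc n" for x i
      using pos[of x] r(4)[of x i] that s(1) by (cases "i = Suc n") auto
  qed (use s r in auto)
qed

text \<open>At a multiple root the differentiated recurrence would read \<open>v + r y = A y\<close>
  with \<open>A v = r v\<close> and \<open>v > 0\<close>. In a row where \<open>y / v\<close> is
  maximal, positivity of \<open>A\<close> gives \<open>(A y) \<le> r y\<close>, a
  contradiction.\<close>

lemma root_derivative_nonzero: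
  assumes n: "n \<ge> 1" and root: "poly (U n) r = 0" and pos: "\<And>i. i < n \<Longrightarrow> poly (U i) r > 0"
  shows "poly (pderiv (U n)) r \<noteq> 0"
proof
  assume d0: "poly (pderiv (U n)) r = 0"
  define v where "v i = poly (U i) r" for i
  define y where "y i = poly (pderiv (U i)) r" for i
  define t where "t = Max ((\<lambda>i. y i / v i) ` {..<n})"
  have "t \<in> (\<lambda>i. y i / v i) ` {..<n}"
    unfolding t_def using n by (intro Max_in) (auto simp: lessThan_empty_iff)
  then obtain k where k: "k < n" "t = y k / v k" by auto
  have vpos: "v i > 0" if "i < n" for i using pos that unfolding v_def by simp
  have le: "y i \<le> t * v i" if "i \<le> n" for i
  proof (cases "i = n")
    case True
    then show ?thesis using d0 root unfolding v_def y_def by simp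
  next
    case False
    then have "y i / v i \<le> t" unfolding t_def using that by (intro Max_ge) auto
    then show ?thesis using vpos[of i] False that by (simp add: field_simps)
  qed
  have "v k + r * y k = (\<Sum>i\<le>Suc k. a k i * y i)"
    unfolding v_def y_def by (rule rec_pderiv)
  also have "\<dots> \<le> (\<Sum>i\<le>Suc k. a k i * (t * v i))"
    using k(1) le a_pos[of _ k] by (intro sum_mono mult_left_mono) (auto intro: less_imp_le)
  also have "\<dots> = t * (\<Sum>i\<le>Suc k. a k i * v i)"
    by (simp only: sum_distrib_left mult.left_commute)
  also have "\<dots> = t * (r * v k)"
    unfolding v_def rec_poly[of r k, symmetric] by simp
  also have "\<dots> = r * y k"
    using k vpos[of k] by simp
  finally show False using vpos[OF k(1)] by simp
qed

text \<open>Gershgorin's theorem for the recurrence matrix conjugated by its positive eigenvector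
  \<open>(U i) r\<close>: every Gershgorin disc is internally tangent at \<open>r\<close> to the circle of radius \<open>r\<close>.\<close>

lemma other_roots_smaller:
  assumes n: "n \<ge> 1" and "r > 0" and root: "poly (U n) r = 0"
    and pos: "\<And>i. i < n \<Longrightarrow> poly (U i) r > 0"
    and z: "poly (cpoly (U n)) z = 0" "z \<noteq> of_real r"
  shows "norm z < r"
proof (cases "z = 0")
  case True
  then show ?thesis using \<open>r > 0\<close> by simp
next
  case False
  define v where "v i = poly (U i) r" for i
  define w where "w i = poly (cpoly (U i)) z" for i
  \<comment> \<open>The rescaled eigenvector is largest at \<open>k\<close>; row \<open>k\<close>
    yields the disc containing \<open>z\<close>.\<close>
  define t where "t = Max ((\<lambda>i. norm (w i) / v i) ` {..<n})"
  have "t \<in> (\<lambda>i. norm (w i) / v i) ` {..<n}"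
    unfolding t_def using n by (intro Max_in) (auto simp: lessThan_empty_iff)
  then obtain k where k: "k < n" "t = norm (w k) / v k" by auto
  have vpos: "v i > 0" if "i < n" for i using pos that unfolding v_def by simp
  have le': "norm (w i) / v i \<le> t" if "i < n" for i
    unfolding t_def using that by (intro Max_ge) auto
  have le: "norm (w i) \<le> t * v i" if "i \<le> n" for i
  proof (cases "i = n")
    case True
    then show ?thesis using z root unfolding v_def w_def by simp
  next
    case False
    then show ?thesis using le'[of i] vpos[of i] that by (simp add: field_simps)
  qed
  \<comment> \<open>Here \<open>w 0 = c * z\<close>, which is why \<open>z = 0\<close> was treated
    apart. It ensures \<open>t > 0\<close>, so \<open>t\<close> can be cancelled.\<close>
  have "w 0 \<noteq> 0"
    using False c_pos unfolding w_def by (simp add: U_0 map_poly_pCons)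
  then have "norm (w 0) / v 0 > 0" using vpos[of 0] n by simp
  then have tpos: "t > 0" using le'[of 0] n by simp
  have wk: "norm (w k) = t * v k" using k vpos[of k] by simp
  let ?I = "{..Suc k} - {k}"
  have split: "(\<Sum>i\<le>Suc k. f i) = f k + (\<Sum>i\<in>?I. f i)" for f :: "nat \<Rightarrow> 'b::comm_monoid_add"
    by (rule sum.remove) auto
  have "z * w k = (\<Sum>i\<le>Suc k. of_real (a k i) * w i)"
    unfolding w_def by (rule rec_cpoly)
  then have "(z - of_real (a k k)) * w k = (\<Sum>i\<in>?I. of_real (a k i) * w i)"
    unfolding split by (simp add: algebra_simps)
  then have "norm (z - of_real (a k k)) * norm (w k) = norm (\<Sum>i\<in>?I. of_real (a k i) * w i)"
    by (metis norm_mult)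
  also have "\<dots> \<le> (\<Sum>i\<in>?I. a k i * (t * v i))"
  proof (rule sum_norm_le)
    fix i assume "i \<in> ?I"
    then show "norm (of_real (a k i) * w i) \<le> a k i * (t * v i)"
      using a_pos[of i k] le[of i] k(1) by (auto simp: norm_mult)
  qed
  also have "\<dots> = t * (\<Sum>i\<in>?I. a k i * v i)"
    by (simp only: sum_distrib_left mult.left_commute)
  \<comment> \<open>Row \<open>k\<close> of the eigenvector equation for \<open>v\<close>, without
    its diagonal term, gives the radius of the disc.\<close>
  also have "(\<Sum>i\<in>?I. a k i * v i) = (r - a k k) * v k"
    using rec_poly[of r k] unfolding split v_def by (simp add: algebra_simps)
  finally have "norm (z - of_real (a k k)) * (t * v k) \<le> (r - a k k) * (t * v k)"
    unfolding wk by (simp add: algebra_simps)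
  then have "norm (z - of_real (a k k)) \<le> r - a k k"
    using tpos vpos[OF k(1)] by simp
  then show ?thesis
    using norm_less_of_internally_tangent_disc[of "a k k" z r] a_pos[of k k] z(2) by simp
qed

end

section \<open>The reciprocal of the alternating divisor series\<close>

text \<open>A crude quadratic bound, enough against the exponential growth of the coefficients of
  \<open>B\<close> in \<open>recip_pos\<close>.\<close>

lemma divisor_sum_le: "2 * divisor_sum k \<le> k * (k + 1)"
proof (cases "k = 0")
  \<comment> \<open>The set of divisors of 0 is infinite, so the sum over it is 0 by
    convention.\<close>
  case True
  then show ?thesis by (simp add: divisor_sum_def)
next
  case False
  have "divisor_sum k \<le> \<Sum>{0..k}"
    unfolding divisor_sum_def using False by (intro sum_mono2) (auto dest: dvd_imp_le)
  also have "\<dots> = k * (k + 1) div 2"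
    using gauss_sum_nat[of k] by (simp add: atLeast0AtMost)
  finally show ?thesis by simp
qed

text \<open>An executable form, used to evaluate the first ten values.\<close>

lemma divisor_sum_code:
  "k > 0 \<Longrightarrow> divisor_sum k = sum_list (filter (\<lambda>d. d dvd k) [1..<Suc k])"
proof -
  assume "k > 0"
  then have "{d. d dvd k} = set (filter (\<lambda>d. d dvd k) [1..<Suc k])"
    by (auto dest: dvd_imp_le intro: Suc_leI dvd_pos_nat simp: less_Suc_eq_le)
  then show ?thesis
    unfolding divisor_sum_def
    by (metis distinct_filter distinct_upt sum.distinct_set_conv_list map_ident)
qed

definition alt_sigma :: "real fps" where
  "alt_sigma = Abs_fps (\<lambda>k. (-1) ^ k * real (divisor_sum (Suc k)))"

definition recip :: "real fps" where
  "recip = inverse alt_sigma"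

lemma divisor_sum_small:
  "divisor_sum 1 = 1" "divisor_sum 2 = 3" "divisor_sum 3 = 4" "divisor_sum 4 = 7"
  "divisor_sum 5 = 6" "divisor_sum 6 = 12" "divisor_sum 7 = 8" "divisor_sum 8 = 15"
  "divisor_sum 9 = 13" "divisor_sum 10 = 18"
  by (subst divisor_sum_code, simp, code_simp)+

lemma recip_mult: "recip * alt_sigma = 1"
proof -
  have "fps_nth alt_sigma 0 \<noteq> 0"
    using divisor_sum_small by (simp add: alt_sigma_def)
  then show ?thesis unfolding recip_def by (rule inverse_mult_eq_1)
qed

text \<open>The approximation \<open>A = (1 + X - X\<^sup>2) / (1 - 2 X)\<close> agrees with \<open>recip\<close> up to
  order 3 but grows more slowly, so that \<open>A * alt_sigma = 1 - B\<close> where \<open>B\<close> has nonnegative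
  coefficients; then \<open>recip = A + B * recip\<close> forces positivity.\<close>

lemma recip_pos: "fps_nth recip n > 0"
proof -
  \<comment> \<open>\<open>G\<close> is \<open>1 / (1 - 2 X)\<close>; the coefficients of
    \<open>A\<close> are 1, 3, 5, 10, 20, ..., doubling from 5 on.\<close>
  define G :: "real fps" where "G = Abs_fps (\<lambda>n. 2 ^ n)"
  define A :: "real fps" where "A = G + fps_X * G - fps_X * (fps_X * G)"
  define B where "B = 1 - A * alt_sigma"
  have G: "G = 1 + 2 * fps_X * G"
  proof (rule fps_ext)
    fix n show "fps_nth G n = fps_nth (1 + 2 * fps_X * G) n"
      by (cases n) (simp_all add: G_def mult.assoc numeral_fps_const)
  qed
  have A_pos: "fps_nth A n > 0" for n
    by (cases n; cases "n - 1") (auto simp: A_def G_def)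
  \<comment> \<open>Multiplication by \<open>1 - 2 X\<close> clears the denominator of
    \<open>A\<close> and leads to the linear recurrence \<open>B_rec\<close>.\<close>
  have "(1 - 2 * fps_X) * G = 1"
    using G by (simp add: algebra_simps)
  moreover have "(1 - 2 * fps_X) * A = (1 + fps_X - fps_X * fps_X) * ((1 - 2 * fps_X) * G)"
    unfolding A_def by (simp add: algebra_simps)
  ultimately have "(1 - 2 * fps_X) * A = 1 + fps_X - fps_X * fps_X"
    by simp
  then have "(1 - 2 * fps_X) * B = (1 - 2 * fps_X) - (1 + fps_X - fps_X * fps_X) * alt_sigma"
    unfolding B_def by (simp add: right_diff_distrib mult.assoc[symmetric])
  then have B_eq: "B = 2 * (fps_X * B) + 1 - 2 * fps_X
      - alt_sigma - fps_X * alt_sigma + fps_X * (fps_X * alt_sigma)"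
    by (simp add: algebra_simps)
  have B_0: "fps_nth B 0 = 0"
    by (subst B_eq) (use divisor_sum_small in \<open>simp add: alt_sigma_def numeral_fps_const\<close>)
  have B_1: "fps_nth B 1 = 0"
    by (subst B_eq)
      (use divisor_sum_small B_0 in \<open>simp add: alt_sigma_def numeral_fps_const numeral_2_eq_2\<close>)
  have B_rec: "fps_nth B (Suc (Suc n)) = 2 * fps_nth B (Suc n)
      - fps_nth alt_sigma (Suc (Suc n)) - fps_nth alt_sigma (Suc n) + fps_nth alt_sigma n" for n
    by (subst B_eq) (simp add: numeral_fps_const)
  \<comment> \<open>Values up to index 9, the first at which the bound in \<open>B_large\<close>
    holds.\<close>
  have B_small: "fps_nth B 2 = 0" "fps_nth B 3 = 0" "fps_nth B 4 = 5" "fps_nth B 5 = 9"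
    "fps_nth B 6 = 28" "fps_nth B 7 = 51" "fps_nth B 8 = 112" "fps_nth B 9 = 214"
    using divisor_sum_small B_1 B_rec[of 0] B_rec[of 1] B_rec[of 2] B_rec[of 3] B_rec[of 4]
      B_rec[of 5] B_rec[of 6] B_rec[of 7]
    by (simp_all add: alt_sigma_def numeral_2_eq_2[symmetric])
  have S_le: "\<bar>fps_nth alt_sigma n\<bar> \<le> (real n + 1) * (real n + 2) / 2" for n
  proof -
    have "real (2 * divisor_sum (Suc n)) \<le> real (Suc n * (Suc n + 1))"
      using divisor_sum_le[of "Suc n"] by (simp only: of_nat_le_iff)
    then show ?thesis by (simp add: alt_sigma_def abs_mult algebra_simps)
  qed
  \<comment> \<open>The quadratic \<open>q\<close> solves the worst case of \<open>B_rec\<close>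
    exactly: \<open>q (n + 1)\<close> is \<open>2 * q n\<close> minus the three bounds from
    \<open>S_le\<close>.\<close>
  have B_large: "fps_nth B n \<ge> (3 * (real n)\<^sup>2 + 15 * real n + 26) / 2" if "n \<ge> 9" for n
    using that
  proof (induction n rule: nat_induct_at_least)
    case base
    then show ?case using B_small by simp
  next
    case (Suc n)
    then obtain m where m: "n = Suc m" by (cases n) auto
    show ?case
      using Suc.IH B_rec[of m] S_le[of m] S_le[of "Suc m"] S_le[of "Suc (Suc m)"] unfolding m
      by (simp add: power2_eq_square algebra_simps abs_le_iff)
  qed
  have B_nonneg: "fps_nth B n \<ge> 0" for n
  proof (cases "n \<ge> 9")
    case True
    have "0 \<le> (3 * (real n)\<^sup>2 + 15 * real n + 26) / 2" by simp
    then show ?thesis using B_large[OF True] by linarith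
  next
    case False
    then have "n \<in> {0,1,2,3,4,5,6,7,8}" by auto
    then show ?thesis using B_0 B_1 B_small by auto
  qed
  have "B * recip = recip - A * (recip * alt_sigma)"
    unfolding B_def by (simp add: algebra_simps)
  then have recip_eq: "recip = A + B * recip"
    by (simp add: recip_mult)
  show ?thesis
  proof (induction n rule: less_induct)
    case (less n)
    \<comment> \<open>As \<open>B\<close> has constant term 0, only coefficients of
      \<open>recip\<close> below \<open>n\<close> contribute.\<close>
    have "fps_nth (B * recip) n \<ge> 0"
      unfolding fps_mult_nth
    proof (rule sum_nonneg)
      fix i assume "i \<in> {0..n}"
      then show "0 \<le> fps_nth B i * fps_nth recip (n - i)"
        using B_0 B_nonneg[of i] less[of "n - i"] by (cases "i = 0") auto
    qed
    then show ?case
      by (subst recip_eq) (use A_pos[of n] in simp)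
  qed
qed

section \<open>Reflected D'Arcais polynomials\<close>

definition reflected :: "(nat \<Rightarrow> real) \<Rightarrow> nat \<Rightarrow> real poly" where
  "reflected h m = smult ((-1) ^ m) (pcompose (darcais h m) [:0, -1:])"

lemma poly_reflected: "poly (reflected h m) x = (-1) ^ m * poly (darcais h m) (- x)"
  by (simp add: reflected_def poly_pcompose)

lemma poly_cpoly_reflected:
  "poly (cpoly (reflected h m)) z = (-1) ^ m * poly (darcais_complex h m) (- z)"
  by (simp add: reflected_def cpoly_smult poly_cpoly_reflect darcais_complex_def)

text \<open>One sign of \<open>(-1) ^ Suc m\<close> cancels that of \<open>- x\<close>; the rest
  splits as \<open>(-1) ^ k * (-1) ^ (m - k)\<close>, which produces
  \<open>alt_sigma\<close>.\<close>

lemma reflected_recurrence: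
  assumes "h (Suc m) > 0"
  shows "h (Suc m) * poly (reflected h (Suc m)) x
    = x * (\<Sum>k\<le>m. fps_nth alt_sigma k * poly (reflected h (m - k)) x)"
proof -
  have "h (Suc m) * poly (darcais h (Suc m)) (- x)
      = - x * (\<Sum>k=1..Suc m. real (divisor_sum k) * poly (darcais h (Suc m - k)) (- x))"
    using assms by (subst darcais.simps(2)) (simp_all add: poly_sum del: sum.cl_ivl_Suc darcais.simps)
  also have "(\<Sum>k=1..Suc m. real (divisor_sum k) * poly (darcais h (Suc m - k)) (- x))
      = (\<Sum>k\<le>m. real (divisor_sum (Suc k)) * poly (darcais h (m - k)) (- x))"
    unfolding One_nat_def sum.shift_bounds_cl_Suc_ivl by (simp add: atLeast0AtMost del: darcais.simps)
  finally have "h (Suc m) * poly (reflected h (Suc m)) x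
      = x * (\<Sum>k\<le>m. (-1) ^ m * (real (divisor_sum (Suc k)) * poly (darcais h (m - k)) (- x)))"
    by (simp add: poly_reflected sum_distrib_left[symmetric] mult.left_commute[of "h (Suc m)"]
        del: darcais.simps)
  also have "(\<Sum>k\<le>m. (-1) ^ m * (real (divisor_sum (Suc k)) * poly (darcais h (m - k)) (- x)))
      = (\<Sum>k\<le>m. fps_nth alt_sigma k * poly (reflected h (m - k)) x)"
  proof (rule sum.cong)
    fix k assume "k \<in> {..m}"
    then have "(-1::real) ^ m = (-1) ^ k * (-1) ^ (m - k)"
      by (simp add: power_add[symmetric])
    then show "(-1) ^ m * (real (divisor_sum (Suc k)) * poly (darcais h (m - k)) (- x))
        = fps_nth alt_sigma k * poly (reflected h (m - k)) x"
      by (simp add: poly_reflected alt_sigma_def del: darcais.simps)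
  qed simp
  finally show ?thesis .
qed

text \<open>For fixed \<open>x\<close> the recurrence is a convolution
  \<open>H = x * alt_sigma * R\<close> of series in the index; multiplying by \<open>recip\<close>
  isolates \<open>R\<close>. Agreement at all real \<open>x\<close> gives the polynomial
  identity.\<close>

lemma reflected_inverse_recurrence:
  assumes "\<And>m. m \<ge> 1 \<Longrightarrow> h m > 0"
  shows "pCons 0 (reflected h m)
    = (\<Sum>i\<le>m. smult (fps_nth recip (m - i) * h (Suc i)) (reflected h (Suc i)))"
proof -
  have "x * poly (reflected h m) x
      = (\<Sum>i\<le>m. fps_nth recip (m - i) * h (Suc i) * poly (reflected h (Suc i)) x)" for x
  proof -
    define R where "R = Abs_fps (\<lambda>m. poly (reflected h m) x)"
    define H where "H = Abs_fps (\<lambda>m. h (Suc m) * poly (reflected h (Suc m)) x)"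
    have "H = fps_const x * (alt_sigma * R)"
    proof (rule fps_ext)
      fix m show "fps_nth H m = fps_nth (fps_const x * (alt_sigma * R)) m"
        using reflected_recurrence[of h m x] assms[of "Suc m"]
        by (simp add: H_def R_def fps_mult_nth[of alt_sigma] atLeast0AtMost)
    qed
    then have "H * recip = fps_const x * R * (recip * alt_sigma)"
      by (simp add: mult_ac)
    then have "fps_nth (H * recip) m = x * poly (reflected h m) x"
      by (simp add: recip_mult R_def)
    then show ?thesis
      unfolding fps_mult_nth by (simp add: H_def atLeast0AtMost mult_ac)
  qed
  then show ?thesis
    by (simp add: poly_eq_poly_eq_iff[symmetric] poly_sum fun_eq_iff)
qed

section \<open>Transfer to the zeros of the D'Arcais polynomials\<close>

theorem theorem2p1:
  fixes h :: "nat \<Rightarrow> real" and n :: nat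
  assumes "\<And>m. m \<ge> 1 \<Longrightarrow> h m > 0"
    and "h 1 = 1"
    and "n \<ge> 2"
  shows "\<exists>\<alpha>. unique_zero_of_maximal_modulus (darcais_complex h n) \<alpha> \<and>
           \<alpha> \<in> \<real> \<and> Re \<alpha> < 0 \<and> order \<alpha> (darcais_complex h n) = 1"
proof -
  interpret hessenberg_polys "\<lambda>m. reflected h (Suc m)" "\<lambda>m i. fps_nth recip (Suc m - i) * h (Suc i)" 1
  proof
    show "reflected h (Suc 0) = [:0, 1:]"
      using assms(2) divisor_sum_small(1) by (simp add: reflected_def pcompose_pCons)
    show "fps_nth recip (Suc m - i) * h (Suc i) > 0" for m i
      using recip_pos assms(1)[of "Suc i"] by simp
    show "pCons 0 (reflected h (Suc m)) = (\<Sum>i\<le>Suc m.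
        smult (fps_nth recip (Suc m - i) * h (Suc i)) (reflected h (Suc i)))" for m
      by (rule reflected_inverse_recurrence[OF assms(1)])
  qed simp
  \<comment> \<open>By the index shift, \<open>reflected h n\<close> is the locale's
    \<open>U k\<close>; \<open>n \<ge> 2\<close> provides the \<open>k \<ge> 1\<close> required
    there.\<close>
  define k where "k = n - 1"
  have k: "k \<ge> 1" "n = Suc k" using assms(3) unfolding k_def by auto
  obtain r where r: "r > 0" "poly (reflected h n) r = 0"
    "\<And>i. i < k \<Longrightarrow> poly (reflected h (Suc i)) r > 0"
    using largest_root[OF k(1)] k(2) by blast
  define p where "p = darcais_complex h n"
  have roots: "poly p z = 0 \<longleftrightarrow> poly (cpoly (reflected h n)) (- z) = 0" for z
    by (simp add: poly_cpoly_reflected p_def)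
  have root: "poly p (- of_real r) = 0"
    using r(2) by (simp add: roots poly_cpoly_of_real)
  have other: "norm z < r" if "poly p z = 0" "z \<noteq> - of_real r" for z
    using other_roots_smaller[OF k(1) r(1), of "- z"] r(2,3) that roots[of z] k(2)
    by (metis equation_minus_iff norm_minus_cancel)
  \<comment> \<open>By the chain rule, reflection changes the derivative only by a sign.\<close>
  have "poly (pderiv (darcais h n)) (- r) \<noteq> 0"
    using root_derivative_nonzero[OF k(1), of r] r(2,3) k(2)
    by (simp add: reflected_def pderiv_minus pderiv_smult pderiv_pcompose pderiv_pCons poly_pcompose
        del: darcais.simps)
  moreover have "pderiv p = cpoly (pderiv (darcais h n))"
    unfolding p_def darcais_complex_def
    by (simp add: poly_eq_iff coeff_pderiv coeff_map_poly)
  ultimately have deriv: "poly (pderiv p) (- of_real r) \<noteq> 0"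
    using poly_cpoly_of_real[of "pderiv (darcais h n)" "- r"] by simp
  then have "p \<noteq> 0" by auto
  then have "order (- of_real r) p = Suc (order (- of_real r) (pderiv p))"
    using root by (rule order_pderiv)
  then have "order (- of_real r) p = 1"
    using deriv by (simp add: order_0I)
  then show ?thesis
    using root other r(1) unfolding unique_zero_of_maximal_modulus_def p_def
    by (intro exI[of _ "- of_real r"]) auto
qed

end
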